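(* Let $A$ be a non-zero complex $m\times n$ matrix. Then $$\frac{\|A\|}{8\sqrt{2}\sqrt{\log h(A)+2}} \le \|A\|_{\Delta} \le \|A\|.$$
   Context: For a complex $m\times n$ matrix $A$: $\|A\|=\|A\|_2$ is the operator norm induced by the Euclidean norm; $\|A\|_1$ is the induced $\ell^1$ operator norm (the largest absolute column sum); $\|A\|_\infty$ is the induced $\ell^\infty$ operator norm (the largest absolute row sum). The height of a non-zero $A$ is $h(A):=\sqrt{\|A\|_1\|A\|_\infty}/\|A\|$ (one has $h(A)\ge 1$). The discrete norm is $\|A\|_{\Delta}:=\max_{0\ne\xi\in\{0,1\}^n}\|A\xi\|/\|\xi\|$, the maximum over non-zero binary vectors, with $\|\cdot\|$ the Euclidean norm. $\log$ denotes the natural logarithm. *)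

theory Defs
  imports "HOL-Analysis.Analysis"
begin

definition norm_l1 :: "complex ^ 'n \<Rightarrow> real" where
  "norm_l1 x = (\<Sum>i\<in>UNIV. norm (x $ i))"

text \<open>The library constant \<open>infnorm\<close> is not the complex sup norm: on \<open>complex ^ 'n\<close> it
  takes the maximum over real and imaginary parts separately.\<close>

definition norm_linf :: "complex ^ 'n \<Rightarrow> real" where
  "norm_linf x = Max (range (\<lambda>i. norm (x $ i)))"

definition mat_norm_1 :: "complex ^ 'n ^ 'm \<Rightarrow> real" where
  "mat_norm_1 A = (SUP x\<in>UNIV - {0}. norm_l1 (A *v x) / norm_l1 x)"

definition mat_norm_inf :: "complex ^ 'n ^ 'm \<Rightarrow> real" where
  "mat_norm_inf A = (SUP x\<in>UNIV - {0}. norm_linf (A *v x) / norm_linf x)"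

text \<open>On \<open>complex ^ 'n\<close> the type class \<open>norm\<close> is the Euclidean norm, so the library's
  \<open>onorm\<close> is the spectral norm.\<close>

definition mat_norm :: "complex ^ 'n ^ 'm \<Rightarrow> real" where
  "mat_norm A = onorm (\<lambda>x. A *v x)"

definition height :: "complex ^ 'n ^ 'm \<Rightarrow> real" where
  "height A = sqrt (mat_norm_1 A * mat_norm_inf A) / mat_norm A"

definition binary_vectors :: "(complex ^ 'n) set" where
  "binary_vectors = {\<xi>. \<forall>i. \<xi> $ i \<in> {0, 1}}"

definition discrete_norm :: "complex ^ 'n ^ 'm \<Rightarrow> real" where
  "discrete_norm A = Max ((\<lambda>\<xi>. norm (A *v \<xi>) / norm \<xi>) ` (binary_vectors - {0}))"


text \<open>\<open>Max\<close> in \<open>discrete_norm\<close> ranges over a finite nonempty set.\<close>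

lemma finite_binary_vectors: "finite (binary_vectors :: (complex ^ 'n) set)"
proof -
  have "(binary_vectors :: (complex ^ 'n) set) \<subseteq> (\<lambda>S. \<chi> i. if i \<in> S then 1 else 0) ` UNIV"
  proof
    fix x :: "complex ^ 'n" assume "x \<in> binary_vectors"
    then have "x = (\<chi> i. if i \<in> {i. x $ i = 1} then 1 else 0)"
      by (auto simp: binary_vectors_def vec_eq_iff)
    then show "x \<in> (\<lambda>S. \<chi> i. if i \<in> S then 1 else 0) ` UNIV" by blast
  qed
  then show ?thesis by (rule finite_subset) simp
qed

lemma binary_vectors_nonzero: "(binary_vectors :: (complex ^ 'n) set) - {0} \<noteq> {}"
proof -
  have "(1 :: complex ^ 'n) \<in> binary_vectors - {0}"
    by (simp add: binary_vectors_def)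
  then show ?thesis by blast
qed

lemma norm_l1_pos: "x \<noteq> 0 \<Longrightarrow> norm_l1 x > 0"
  by (auto simp: norm_l1_def vec_eq_iff intro!: sum_pos2)

lemma norm_le_linf: "norm (x $ i) \<le> norm_linf x"
  by (simp add: norm_linf_def)

lemma norm_linf_le_iff: "norm_linf x \<le> c \<longleftrightarrow> (\<forall>i. norm (x $ i) \<le> c)"
  by (simp add: norm_linf_def)

lemma norm_linf_pos: "x \<noteq> 0 \<Longrightarrow> norm_linf x > 0"
  by (metis norm_le_linf order_less_le_trans vec_eq_iff zero_index zero_less_norm_iff)

lemma mat_norm_1_eq_max_column_sum:
  fixes A :: "complex ^ 'n ^ 'm"
  shows "mat_norm_1 A = Max (range (\<lambda>j. \<Sum>i\<in>UNIV. norm (A $ i $ j)))" (is "_ = ?M")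
proof -
  have le: "norm_l1 (A *v x) / norm_l1 x \<le> ?M" if "x \<noteq> 0" for x
  proof -
    have "norm_l1 (A *v x) \<le> (\<Sum>i\<in>UNIV. \<Sum>j\<in>UNIV. norm (A $ i $ j) * norm (x $ j))"
      unfolding norm_l1_def matrix_vector_mult_def
      by (auto simp flip: norm_mult intro!: sum_mono norm_sum)
    also have "\<dots> = (\<Sum>j\<in>UNIV. (\<Sum>i\<in>UNIV. norm (A $ i $ j)) * norm (x $ j))"
      by (subst sum.swap) (simp add: sum_distrib_right)
    also have "\<dots> \<le> (\<Sum>j\<in>UNIV. ?M * norm (x $ j))"
      by (intro sum_mono mult_right_mono) auto
    finally show ?thesis
      using norm_l1_pos[OF that] by (simp add: norm_l1_def sum_distrib_left divide_le_eq)
  qed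
  have "?M \<in> range (\<lambda>j. \<Sum>i\<in>UNIV. norm (A $ i $ j))"
    by (rule Max_in) auto
  then obtain j where j: "?M = (\<Sum>i\<in>UNIV. norm (A $ i $ j))" by blast
  have one: "norm_l1 (axis j (1::complex)) = 1"
    by (simp add: norm_l1_def axis_def if_distrib cong: if_cong)
  have "norm_l1 (A *v axis j 1) / norm_l1 (axis j (1::complex)) = ?M"
    unfolding one j
    by (simp add: norm_l1_def matrix_vector_mult_def axis_def if_distrib cong: if_cong)
  then have "?M \<in> (\<lambda>x. norm_l1 (A *v x) / norm_l1 x) ` (UNIV - {0})"
    by (intro image_eqI[of _ _ "axis j 1"]) (auto simp: axis_eq_0_iff)
  then show ?thesis
    unfolding mat_norm_1_def using le by (intro cSup_eq_maximum) auto
qed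

lemma mat_norm_inf_eq_max_row_sum:
  fixes A :: "complex ^ 'n ^ 'm"
  shows "mat_norm_inf A = Max (range (\<lambda>i. \<Sum>j\<in>UNIV. norm (A $ i $ j)))" (is "_ = ?M")
proof -
  have le: "norm_linf (A *v x) / norm_linf x \<le> ?M" if "x \<noteq> 0" for x
  proof -
    have "norm ((A *v x) $ i) \<le> ?M * norm_linf x" for i
    proof -
      have "norm ((A *v x) $ i) \<le> (\<Sum>j\<in>UNIV. norm (A $ i $ j) * norm (x $ j))"
        unfolding matrix_vector_mult_def by (auto simp flip: norm_mult intro!: norm_sum)
      also have "\<dots> \<le> (\<Sum>j\<in>UNIV. norm (A $ i $ j) * norm_linf x)"
        by (intro sum_mono mult_left_mono norm_le_linf) auto
      also have "\<dots> = (\<Sum>j\<in>UNIV. norm (A $ i $ j)) * norm_linf x"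
        by (simp add: sum_distrib_right)
      also have "\<dots> \<le> ?M * norm_linf x"
        using norm_linf_pos[OF that] by (intro mult_right_mono) auto
      finally show ?thesis .
    qed
    then show ?thesis
      using norm_linf_pos[OF that] by (simp add: norm_linf_le_iff divide_le_eq)
  qed
  have "?M \<in> range (\<lambda>i. \<Sum>j\<in>UNIV. norm (A $ i $ j))"
    by (rule Max_in) auto
  then obtain i where i: "?M = (\<Sum>j\<in>UNIV. norm (A $ i $ j))" by blast
  define x :: "complex ^ 'n"
    where "x = (\<chi> j. if A $ i $ j = 0 then 1 else cnj (sgn (A $ i $ j)))"
  have n1: "norm (x $ j) = 1" for j
    by (simp add: x_def norm_sgn)
  have x0: "x \<noteq> 0"
    using n1 by (metis norm_zero zero_index zero_neq_one)
  have one: "norm_linf x = 1"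
    by (simp add: norm_linf_def n1)
  have *: "A $ i $ j * x $ j = of_real (norm (A $ i $ j))" for j
    by (simp add: x_def sgn_eq complex_norm_square[symmetric] power2_eq_square)
  have "(A *v x) $ i = of_real ?M"
    unfolding i by (simp add: matrix_vector_mult_def *)
  moreover have "?M \<ge> 0"
    unfolding i by (simp add: sum_nonneg)
  ultimately have "?M \<le> norm_linf (A *v x) / norm_linf x"
    using norm_le_linf[of "A *v x" i] by (simp add: one)
  with le[OF x0] have "?M = norm_linf (A *v x) / norm_linf x" by simp
  then have "?M \<in> (\<lambda>x. norm_linf (A *v x) / norm_linf x) ` (UNIV - {0})"
    using x0 by blast
  then show ?thesis
    unfolding mat_norm_inf_def using le by (intro cSup_eq_maximum) auto
qed

end

theory Submission
  imports Defs
begin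

text \<open>
  Let \<open>D\<close> be the discrete norm, \<open>P\<close> and \<open>Q\<close> the largest absolute column and row sums, and bound
  \<open>x\<^sup>* A y\<close> for unit vectors \<open>x\<close>, \<open>y\<close>. Slice \<open>y\<close> into layers at dyadic heights \<open>t\<close>, and against
  the layer at height \<open>t\<close> keep only the entries of \<open>x\<close> with \<open>b t / 2^K < \<bar>x\<^sub>i\<bar> \<le> b t\<close>.
  The discarded pairs satisfy \<open>\<bar>x\<^sub>i\<bar> > b t\<close> or \<open>\<bar>x\<^sub>i\<bar> \<le> b t / 2^K\<close>, so a Schur-type estimate
  bounds their contribution by \<open>Q / b + 2 b P / 2^K\<close>. A layer is bounded by a multiple of the
  indicator of its support, so in the kept part the operator norm is replaced by \<open>D\<close> at the price
  of a constant. As every \<open>x\<^sub>i\<close> is kept for at most \<open>K\<close> layers, the Cauchy-Schwarz inequality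
  over the layers shows that the kept part is \<open>O(D sqrt K)\<close>. With the optimal \<open>b\<close> and
  \<open>2^K \<ge> 32 h\<^sup>2\<close>, the discarded part is at most half of the operator norm.
\<close>

section \<open>Dyadic slicing of a nonnegative number\<close>

text \<open>The length of the part of the interval from 0 to \<open>y\<close> inside the
  \<open>l\<close>-th dyadic piece: from 0 to \<open>e\<close> for \<open>l = 0\<close>, from
  \<open>e * 2 ^ (l - 1)\<close> to \<open>e * 2 ^ l\<close> otherwise.\<close>

definition layer :: "real \<Rightarrow> real \<Rightarrow> nat \<Rightarrow> real" where
  "layer e y l = min y (e * 2 ^ l) - (if l = 0 then 0 else min y (e * 2 ^ (l - 1)))"

lemma sum_layer: "(\<Sum>l\<le>L. layer e y l) = min y (e * 2 ^ L)"
  by (induction L) (auto simp: layer_def)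

lemma layer_nonneg: "0 \<le> e \<Longrightarrow> 0 \<le> y \<Longrightarrow> 0 \<le> layer e y l"
  by (cases l) (auto simp: layer_def min_def)

text \<open>This piece starts at \<open>e * 2 ^ l\<close> and has that same length. Layer 0 starts
  at 0, so a nonzero layer 0 gives no positive lower bound for \<open>y\<close> in terms of
  \<open>e\<close>.\<close>

lemma layer_Suc_le:
  assumes "0 \<le> e" "0 \<le> y"
  shows "layer e y (Suc l) \<le> (if e * 2 ^ l < y then e * 2 ^ l else 0)"
  using assms by (auto simp: layer_def min_def)

text \<open>The layers telescope, so those up to the last admissible height add up to at most that
  height, which is less than \<open>x / b\<close>.\<close>

lemma sum_low_layers_le:
  assumes "0 \<le> e" "0 \<le> y" "0 < b" "0 \<le> x"
  shows "(\<Sum>l\<le>L. if b * (e * 2 ^ l) < x then layer e y l else 0) \<le> x / b"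
proof (induction L)
  case 0
  have "layer e y 0 \<le> e" by (simp add: layer_def)
  show ?case
  proof (cases "b * e < x")
    case True
    then have "e \<le> x / b" using assms by (simp add: field_simps)
    with \<open>layer e y 0 \<le> e\<close> have "layer e y 0 \<le> x / b" by linarith
    then show ?thesis using True by simp
  next
    case False
    moreover have "0 \<le> x / b" using assms by simp
    ultimately show ?thesis by simp
  qed
next
  case (Suc L)
  show ?case
  proof (cases "b * (e * 2 ^ Suc L) < x")
    case True
    have "(\<Sum>l\<le>Suc L. if b * (e * 2 ^ l) < x then layer e y l else 0) \<le> (\<Sum>l\<le>Suc L. layer e y l)"
      by (intro sum_mono) (use assms layer_nonneg in auto)
    also have "\<dots> \<le> e * 2 ^ Suc L" unfolding sum_layer by simp
    also have "\<dots> \<le> x / b" using True assms by (simp add: field_simps)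
    finally show ?thesis .
  qed (use Suc in simp)
qed

text \<open>A layer outside the window is either low, and all low layers together contribute at most
  \<open>x / b\<close>, or high, and then a nonzero layer forces \<open>x\<close> to be at most
  \<open>2 * a * y\<close>.\<close>

lemma off_window_sum_le:
  fixes x y :: real
  assumes e: "0 < e" "0 \<le> y" "0 < b" "0 \<le> a" "0 < x" "b * e < x"
  shows "x * (\<Sum>l\<le>L. if a * (e * 2 ^ l) < x \<and> x \<le> b * (e * 2 ^ l) then 0 else layer e y l)
    \<le> x\<^sup>2 / b + 2 * a * y\<^sup>2"
proof -
  have nn: "0 \<le> layer e y l" for l using layer_nonneg e by simp
  have high: "x * layer e y l \<le> 2 * a * y * layer e y l" if "x \<le> a * (e * 2 ^ l)" "\<not> b * (e * 2 ^ l) < x" for l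
  proof (cases l)
    \<comment> \<open>Layer 0 is never high: its second condition contradicts
      \<open>b * e < x\<close>.\<close>
    case 0
    then show ?thesis using that e by simp
  next
    case (Suc k)
    show ?thesis
    proof (cases "e * 2 ^ k < y")
      case True
      \<comment> \<open>The factor 2 is the ratio of the upper to the lower end of the layer; a
        nonzero layer has its lower end below \<open>y\<close>.\<close>
      have "x \<le> 2 * a * (e * 2 ^ k)" using that Suc by (simp add: algebra_simps)
      also have "\<dots> \<le> 2 * a * y" using True e by (intro mult_left_mono) auto
      finally show ?thesis using nn by (intro mult_right_mono)
    next
      case False
      then have "layer e y l = 0"
        using layer_Suc_le[of e y k] nn[of l] e Suc by simp
      then show ?thesis by simp
    qed
  qed
  have "x * (\<Sum>l\<le>L. if a * (e * 2 ^ l) < x \<and> x \<le> b * (e * 2 ^ l) then 0 else layer e y l)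
     \<le> (\<Sum>l\<le>L. x * (if b * (e * 2 ^ l) < x then layer e y l else 0) + 2 * a * y * layer e y l)"
    unfolding sum_distrib_left
  proof (intro sum_mono)
    fix l
    have "0 \<le> 2 * a * y * layer e y l" using nn e by simp
    moreover have "0 \<le> x * layer e y l" using nn e by simp
    ultimately show "x * (if a * (e * 2 ^ l) < x \<and> x \<le> b * (e * 2 ^ l) then 0 else layer e y l)
      \<le> x * (if b * (e * 2 ^ l) < x then layer e y l else 0) + 2 * a * y * layer e y l"
      using high[of l] by auto
  qed
  also have "\<dots> = x * (\<Sum>l\<le>L. if b * (e * 2 ^ l) < x then layer e y l else 0) + 2 * a * y * (\<Sum>l\<le>L. layer e y l)"
    by (simp add: sum.distrib sum_distrib_left)
  also have "\<dots> \<le> x * (x / b) + 2 * a * y * y"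
    by (intro add_mono mult_left_mono sum_low_layers_le) (use e in \<open>auto simp: sum_layer\<close>)
  finally show ?thesis by (simp add: power2_eq_square mult.assoc)
qed

text \<open>If \<open>m\<close> is the least exponent with \<open>2 ^ m\<close> at least
  \<open>u\<close>, the window of ratio \<open>2 ^ K\<close> only admits exponents from
  \<open>m\<close> to \<open>m + K - 1\<close>.\<close>

lemma card_dyadic_window_le:
  fixes u :: real
  assumes "u > 0"
  shows "card {l\<in>S. u \<le> 2 ^ l \<and> 2 ^ l < u * 2 ^ K} \<le> K"
proof (cases "{l\<in>S. u \<le> 2 ^ l \<and> 2 ^ l < u * 2 ^ K} = {}")
  case False
  define m where "m = (LEAST l. u \<le> (2::real) ^ l)"
  have ex: "\<exists>l. u \<le> (2::real) ^ l" using False by auto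
  then have m: "u \<le> 2 ^ m" unfolding m_def by (rule LeastI_ex)
  have "{l\<in>S. u \<le> 2 ^ l \<and> 2 ^ l < u * 2 ^ K} \<subseteq> {m..<m+K}"
  proof safe
    fix l assume l: "u \<le> (2::real) ^ l" "(2::real) ^ l < u * 2 ^ K"
    have "(2::real) ^ l < 2 ^ (m + K)"
      using l(2) m by (simp add: power_add) (meson less_le_trans mult_right_mono zero_le_numeral zero_le_power)
    then show "l \<in> {m..<m+K}" using l Least_le[of "\<lambda>l. u \<le> (2::real) ^ l" l] by (simp add: m_def)
  qed
  from card_mono[OF _ this] show ?thesis by simp
qed (use card.empty in \<open>metis zero_le\<close>)

text \<open>A geometric sum of ratio 4 is at most 4/3 of its last term, and the last height that
  counts is below \<open>y\<close>.\<close>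

lemma sum_dyadic_squares_le:
  fixes e y :: real
  assumes "0 < e" "0 \<le> y"
  shows "(\<Sum>l<L. if e * 2 ^ l < y then (e * 2 ^ l)\<^sup>2 else 0) \<le> 4 / 3 * y\<^sup>2"
proof (induction L)
  case (Suc L)
  show ?case
  proof (cases "e * 2 ^ L < y")
    case True
    have "(\<Sum>l<Suc L. if e * 2 ^ l < y then (e * 2 ^ l)\<^sup>2 else 0) \<le> (\<Sum>l<Suc L. (e * 2 ^ l)\<^sup>2)"
      by (intro sum_mono) auto
    also have "\<dots> \<le> 4 / 3 * (e * 2 ^ L)\<^sup>2"
      by (induction L) (auto simp: power_mult_distrib)
    also have "\<dots> \<le> 4 / 3 * y\<^sup>2"
      using True assms by (intro mult_left_mono power_mono) auto
    finally show ?thesis .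
  qed (use Suc in simp)
qed (use assms in simp)

section \<open>Bilinear forms, the operator norm and the Schur test\<close>

lemma Cauchy_Schwarz_sum_le:
  fixes x y :: "complex ^ 'n"
  shows "norm (\<Sum>i\<in>UNIV. cnj (x $ i) * y $ i) \<le> norm x * norm y"
proof -
  have "norm (\<Sum>i\<in>UNIV. cnj (x $ i) * y $ i) \<le> (\<Sum>i\<in>UNIV. \<bar>norm (x $ i)\<bar> * \<bar>norm (y $ i)\<bar>)"
    by (rule order_trans[OF norm_sum]) (simp add: norm_mult)
  also have "\<dots> \<le> norm x * norm y"
    unfolding norm_vec_def by (rule L2_set_mult_ineq)
  finally show ?thesis .
qed

lemma norm_vec_power2: "(norm v)\<^sup>2 = (\<Sum>i\<in>UNIV. (norm (v $ i))\<^sup>2)"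
  by (simp add: norm_vec_def L2_set_def sum_nonneg)

text \<open>Duality: testing \<open>A *v y\<close> against its own normalization recovers its
  Euclidean norm.\<close>

lemma mat_norm_leI:
  fixes A :: "complex ^ 'n ^ 'm"
  assumes R: "0 \<le> R"
    and le: "\<And>x y. norm x = 1 \<Longrightarrow> norm y = 1 \<Longrightarrow> norm (\<Sum>i\<in>UNIV. cnj (x $ i) * (A *v y) $ i) \<le> R"
  shows "mat_norm A \<le> R"
proof -
  have unit: "norm (A *v y) \<le> R" if "norm y = 1" for y
  proof (cases "A *v y = 0")
    case False
    define w where "w = A *v y"
    have w: "norm w \<noteq> 0" using False by (simp add: w_def)
    have "(\<Sum>i\<in>UNIV. cnj ((w /\<^sub>R norm w) $ i) * w $ i) = of_real ((\<Sum>i\<in>UNIV. (norm (w $ i))\<^sup>2) / norm w)"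
      unfolding of_real_divide of_real_sum complex_norm_square sum_divide_distrib
      by (intro sum.cong refl) (simp add: scaleR_conv_of_real[where 'a = complex] divide_inverse mult_ac)
    also have "\<dots> = of_real (norm w)"
      unfolding norm_vec_power2[symmetric] using w by (simp add: power2_eq_square)
    finally show ?thesis
      using le[of "w /\<^sub>R norm w" y] that w by (simp add: w_def)
  qed (use R in simp)
  show ?thesis unfolding mat_norm_def
  proof (rule onorm_le)
    fix v :: "complex ^ 'n"
    show "norm (A *v v) \<le> R * norm v"
    proof (cases "v = 0")
      case False
      have "A *v v = A *v (norm v *\<^sub>R (v /\<^sub>R norm v))" using False by simp
      also have "\<dots> = norm v *\<^sub>R (A *v (v /\<^sub>R norm v))"
        using bounded_linear.linear[OF matrix_vector_mul_bounded_linear] by (rule linear_scale)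
      finally have "norm (A *v v) = norm v * norm (A *v (v /\<^sub>R norm v))" by simp
      also have "\<dots> \<le> norm v * R" using False by (intro mult_left_mono unit) auto
      finally show ?thesis by (simp add: mult.commute)
    qed simp
  qed
qed

text \<open>Each weight depends on one index only, so summing over the other index first produces
  row sums for \<open>x\<close> and column sums for \<open>y\<close>.\<close>

lemma weighted_entry_sum_le:
  fixes A :: "complex ^ 'n ^ 'm" and x :: "complex ^ 'm" and y :: "complex ^ 'n"
  assumes col: "\<And>j. (\<Sum>i\<in>UNIV. norm (A $ i $ j)) \<le> P" and row: "\<And>i. (\<Sum>j\<in>UNIV. norm (A $ i $ j)) \<le> Q"
    and st: "0 \<le> s" "0 \<le> t" and nx: "norm x = 1" and ny: "norm y = 1"
  shows "(\<Sum>i\<in>UNIV. \<Sum>j\<in>UNIV. norm (A $ i $ j) * ((norm (x $ i))\<^sup>2 * s + (norm (y $ j))\<^sup>2 * t)) \<le> Q * s + P * t"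
proof -
  have "(\<Sum>i\<in>UNIV. \<Sum>j\<in>UNIV. norm (A $ i $ j) * ((norm (x $ i))\<^sup>2 * s + (norm (y $ j))\<^sup>2 * t))
      = (\<Sum>i\<in>UNIV. \<Sum>j\<in>UNIV. norm (A $ i $ j) * ((norm (x $ i))\<^sup>2 * s))
      + (\<Sum>i\<in>UNIV. \<Sum>j\<in>UNIV. norm (A $ i $ j) * ((norm (y $ j))\<^sup>2 * t))"
    by (simp add: distrib_left sum.distrib)
  also have "(\<Sum>i\<in>UNIV. \<Sum>j\<in>UNIV. norm (A $ i $ j) * ((norm (y $ j))\<^sup>2 * t))
      = (\<Sum>j\<in>UNIV. \<Sum>i\<in>UNIV. norm (A $ i $ j) * ((norm (y $ j))\<^sup>2 * t))"
    by (rule sum.swap)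
  also have "(\<Sum>i\<in>UNIV. \<Sum>j\<in>UNIV. norm (A $ i $ j) * ((norm (x $ i))\<^sup>2 * s)) + \<dots>
      = (\<Sum>i\<in>UNIV. (\<Sum>j\<in>UNIV. norm (A $ i $ j)) * ((norm (x $ i))\<^sup>2 * s))
      + (\<Sum>j\<in>UNIV. (\<Sum>i\<in>UNIV. norm (A $ i $ j)) * ((norm (y $ j))\<^sup>2 * t))"
    by (simp only: sum_distrib_right)
  also have "\<dots> \<le> (\<Sum>i\<in>UNIV. Q * ((norm (x $ i))\<^sup>2 * s)) + (\<Sum>j\<in>UNIV. P * ((norm (y $ j))\<^sup>2 * t))"
    using st by (intro add_mono sum_mono mult_right_mono row col) auto
  also have "\<dots> = Q * ((norm x)\<^sup>2 * s) + P * ((norm y)\<^sup>2 * t)"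
    by (simp only: sum_distrib_left sum_distrib_right norm_vec_power2)
  finally show ?thesis by (simp add: nx ny)
qed

text \<open>Weighted arithmetic-geometric mean inequality in each entry. The result says that the
  height is at least 1.\<close>

lemma Schur_test:
  fixes A :: "complex ^ 'n ^ 'm"
  assumes pos: "0 < P" "0 < Q"
    and col: "\<And>j. (\<Sum>i\<in>UNIV. norm (A $ i $ j)) \<le> P" and row: "\<And>i. (\<Sum>j\<in>UNIV. norm (A $ i $ j)) \<le> Q"
  shows "mat_norm A \<le> sqrt (P * Q)"
proof (rule mat_norm_leI)
  fix x :: "complex ^ 'm" and y :: "complex ^ 'n" assume xy: "norm x = 1" "norm y = 1"
  \<comment> \<open>The mean inequality requires \<open>s * t = 1 / 4\<close>; subject to this, the
    choice equalizes \<open>Q * s\<close> and \<open>P * t\<close>.\<close>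
  define s t where "s = sqrt P / (2 * sqrt Q)" and "t = sqrt Q / (2 * sqrt P)"
  have st: "0 < s" "0 < t" using pos by (auto simp: s_def t_def)
  have "norm (\<Sum>i\<in>UNIV. cnj (x $ i) * (A *v y) $ i)
     \<le> (\<Sum>i\<in>UNIV. \<Sum>j\<in>UNIV. norm (A $ i $ j) * ((norm (x $ i))\<^sup>2 * s + (norm (y $ j))\<^sup>2 * t))"
    unfolding matrix_vector_mult_def
  proof (simp add: sum_distrib_left, intro sum_norm_le)
    fix i j
    have "2 * (sqrt s * norm (x $ i)) * (sqrt t * norm (y $ j)) \<le> (sqrt s * norm (x $ i))\<^sup>2 + (sqrt t * norm (y $ j))\<^sup>2"
      by (rule sum_squares_bound)
    moreover have "sqrt s * sqrt t = 1 / 2"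
      unfolding real_sqrt_mult[symmetric] using pos by (simp add: s_def t_def real_sqrt_divide)
    then have "2 * (sqrt s * norm (x $ i)) * (sqrt t * norm (y $ j)) = norm (x $ i) * norm (y $ j)"
      by algebra
    ultimately have "norm (x $ i) * norm (y $ j) \<le> (sqrt s * norm (x $ i))\<^sup>2 + (sqrt t * norm (y $ j))\<^sup>2"
      by simp
    then have "norm (x $ i) * norm (y $ j) \<le> (norm (x $ i))\<^sup>2 * s + (norm (y $ j))\<^sup>2 * t"
      using st by (simp add: power_mult_distrib mult.commute)
    then have "norm (A $ i $ j) * (norm (x $ i) * norm (y $ j)) \<le> norm (A $ i $ j) * ((norm (x $ i))\<^sup>2 * s + (norm (y $ j))\<^sup>2 * t)"
      by (rule mult_left_mono) simp
    then show "norm (cnj (x $ i) * (A $ i $ j * y $ j)) \<le> norm (A $ i $ j) * ((norm (x $ i))\<^sup>2 * s + (norm (y $ j))\<^sup>2 * t)"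
      by (simp add: norm_mult mult.left_commute)
  qed
  also have "\<dots> \<le> Q * s + P * t"
    using st by (intro weighted_entry_sum_le col row xy) auto
  also have "Q * s = sqrt (P * Q) / 2"
    using pos real_div_sqrt[of Q] by (simp add: s_def real_sqrt_mult field_simps)
  also have "P * t = sqrt (P * Q) / 2"
    using pos real_div_sqrt[of P] by (simp add: t_def real_sqrt_mult field_simps)
  finally show "norm (\<Sum>i\<in>UNIV. cnj (x $ i) * (A *v y) $ i) \<le> sqrt (P * Q)" by simp
qed (use pos in simp)

section \<open>Bilinear estimates from a bound \<open>D\<close> on binary vectors\<close>

context
  fixes A :: "complex ^ 'n ^ 'm" and D :: real
  assumes D: "\<And>\<xi>. \<xi> \<in> binary_vectors \<Longrightarrow> norm (A *v \<xi>) \<le> D * norm \<xi>"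
begin

lemma discrete_bound_nonneg: "0 \<le> D"
proof -
  have "(1 :: complex ^ 'n) \<in> binary_vectors" by (simp add: binary_vectors_def)
  from D[OF this] have "0 \<le> D * norm (1 :: complex ^ 'n)"
    using norm_ge_zero order_trans by blast
  moreover have "0 < norm (1 :: complex ^ 'n)" by simp
  ultimately show ?thesis by (simp add: zero_le_mult_iff)
qed

text \<open>The sum pairs \<open>x\<close> with the image of the indicator vector of
  \<open>T\<close>, whose norm is \<open>sqrt (card T)\<close>.\<close>

lemma norm_subset_sum_le:
  fixes x :: "complex ^ 'm"
  shows "norm (\<Sum>j\<in>T. \<Sum>i\<in>UNIV. cnj (x $ i) * A $ i $ j) \<le> norm x * (D * sqrt (card T))"
proof -
  define \<xi> :: "complex ^ 'n" where "\<xi> = (\<chi> j. if j \<in> T then 1 else 0)"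
  have b: "\<xi> \<in> binary_vectors" by (simp add: binary_vectors_def \<xi>_def)
  have n: "norm \<xi> = sqrt (card T)"
    by (simp add: norm_vec_def L2_set_def \<xi>_def if_distrib[of norm] if_distrib[of "\<lambda>x. x ^ 2"] sum.If_cases cong: if_cong)
  have "(\<Sum>j\<in>T. \<Sum>i\<in>UNIV. cnj (x $ i) * A $ i $ j) = (\<Sum>i\<in>UNIV. cnj (x $ i) * (A *v \<xi>) $ i)"
    by (subst sum.swap) (simp add: matrix_vector_mult_def \<xi>_def sum_distrib_left if_distrib sum.If_cases cong: if_cong)
  also have "norm \<dots> \<le> norm x * norm (A *v \<xi>)" by (rule Cauchy_Schwarz_sum_le)
  also have "\<dots> \<le> norm x * (D * sqrt (card T))"
    using D[OF b] n by (intro mult_left_mono) auto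
  finally show ?thesis .
qed

text \<open>Splitting the columns by the signs of the real and imaginary parts of their sums reduces the
  bound to sums without absolute values, hence to binary vectors.\<close>

lemma sum_norm_columns_le:
  fixes x :: "complex ^ 'm" and S :: "'n set"
  shows "(\<Sum>j\<in>S. norm (\<Sum>i\<in>UNIV. cnj (x $ i) * A $ i $ j)) \<le> 2 * sqrt 2 * D * norm x * sqrt (card S)"
proof -
  define g where "g j = (\<Sum>i\<in>UNIV. cnj (x $ i) * A $ i $ j)" for j
  \<comment> \<open>Applied with \<open>Re\<close> and \<open>Im\<close> as \<open>f\<close>. The
    split by sign costs a factor \<open>sqrt 2\<close>, and the two applications a factor 2.\<close>
  have part: "(\<Sum>j\<in>S. \<bar>f (g j)\<bar>) \<le> norm x * D * (sqrt 2 * sqrt (card S))"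
    if f: "\<And>T. f (sum g T) = (\<Sum>j\<in>T. f (g j))" "\<And>z. \<bar>f z\<bar> \<le> norm z" for f :: "complex \<Rightarrow> real"
  proof -
    define P N where "P = {j\<in>S. 0 \<le> f (g j)}" and "N = {j\<in>S. \<not> 0 \<le> f (g j)}"
    have S: "S = P \<union> N" "P \<inter> N = {}" by (auto simp: P_def N_def)
    have "(\<Sum>j\<in>S. \<bar>f (g j)\<bar>) = (\<Sum>j\<in>P. \<bar>f (g j)\<bar>) + (\<Sum>j\<in>N. \<bar>f (g j)\<bar>)"
      using S by (simp add: sum.union_disjoint)
    also have "(\<Sum>j\<in>P. \<bar>f (g j)\<bar>) = f (sum g P)"
      unfolding f by (rule sum.cong) (auto simp: P_def)
    also have "(\<Sum>j\<in>N. \<bar>f (g j)\<bar>) = - f (sum g N)"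
      unfolding f sum_negf[symmetric] by (rule sum.cong) (auto simp: N_def)
    also have "f (sum g P) + - f (sum g N) \<le> norm (sum g P) + norm (sum g N)"
      using f(2)[of "sum g P"] f(2)[of "sum g N"] by linarith
    also have "\<dots> \<le> norm x * (D * sqrt (card P)) + norm x * (D * sqrt (card N))"
      unfolding g_def by (intro add_mono norm_subset_sum_le)
    also have "\<dots> = norm x * D * (sqrt (card P) + sqrt (card N))" by (simp add: algebra_simps)
    also have "\<dots> \<le> norm x * D * (sqrt 2 * sqrt (card S))"
    proof (intro mult_left_mono)
      have "card S = card P + card N" using S by (simp add: card_Un_disjoint)
      moreover have "sqrt p + sqrt q \<le> sqrt 2 * sqrt (p + q)" if "0 \<le> p" "0 \<le> q" for p q :: real
        unfolding real_sqrt_mult[symmetric]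
        using that sum_squares_bound[of "sqrt p" "sqrt q"]
        by (intro real_le_rsqrt) (simp add: power2_sum)
      ultimately show "sqrt (card P) + sqrt (card N) \<le> sqrt 2 * sqrt (card S)" by simp
    qed (use discrete_bound_nonneg in auto)
    finally show ?thesis .
  qed
  have "(\<Sum>j\<in>S. norm (g j)) \<le> (\<Sum>j\<in>S. \<bar>Re (g j)\<bar>) + (\<Sum>j\<in>S. \<bar>Im (g j)\<bar>)"
    unfolding sum.distrib[symmetric] by (intro sum_mono cmod_le)
  also have "\<dots> \<le> norm x * D * (sqrt 2 * sqrt (card S)) + norm x * D * (sqrt 2 * sqrt (card S))"
    by (intro add_mono part) (auto simp: abs_Re_le_cmod abs_Im_le_cmod)
  finally show ?thesis by (simp add: g_def algebra_simps)
qed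

text \<open>Here \<open>W i l\<close> means that entry \<open>i\<close> of \<open>x\<close> is kept
  for layer \<open>Suc l\<close>. Each layer is treated as a multiple of the indicator of its
  support, and the layers are then combined by Cauchy-Schwarz, not by adding their separate worst
  cases.\<close>

lemma on_window_sum_le:
  fixes x :: "complex ^ 'm" and y :: "complex ^ 'n" and K L :: nat
  assumes e: "0 < e" and W: "\<And>i. x $ i \<noteq> 0 \<Longrightarrow> card {l. l < L \<and> W i l} \<le> K"
    and nx: "norm x = 1" and ny: "norm y = 1"
  shows "norm (\<Sum>l<L. \<Sum>j\<in>UNIV. (\<Sum>i\<in>UNIV. if W i l then cnj (x $ i) * A $ i $ j else 0)
             * (sgn (y $ j) * of_real (layer e (norm (y $ j)) (Suc l))))
         \<le> 2 * sqrt 2 * D * sqrt (4 / 3 * K)"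
proof -
  define X :: "nat \<Rightarrow> complex ^ 'm" where "X l = (\<chi> i. if W i l then x $ i else 0)" for l
  define S where "S l = {j. e * 2 ^ l < norm (y $ j)}" for l
  define g where "g l j = (\<Sum>i\<in>UNIV. cnj (X l $ i) * A $ i $ j)" for l j
  have g: "(\<Sum>i\<in>UNIV. if W i l then cnj (x $ i) * A $ i $ j else 0) = g l j" for l j
    unfolding g_def X_def by (rule sum.cong) auto
  have "norm (\<Sum>l<L. \<Sum>j\<in>UNIV. g l j * (sgn (y $ j) * of_real (layer e (norm (y $ j)) (Suc l))))
    \<le> (\<Sum>l<L. \<Sum>j\<in>UNIV. norm (g l j * (sgn (y $ j) * of_real (layer e (norm (y $ j)) (Suc l)))))"
    by (intro sum_norm_le norm_sum)
  \<comment> \<open>With absolute values inside the sum, the layer may be enlarged to the constant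
    \<open>e * 2 ^ l\<close> on its support \<open>S l\<close>.\<close>
  also have "\<dots> \<le> (\<Sum>l<L. \<Sum>j\<in>UNIV. norm (g l j) * (if j \<in> S l then e * 2 ^ l else 0))"
  proof (intro sum_mono)
    fix l j
    have "norm (sgn (y $ j)) * layer e (norm (y $ j)) (Suc l) \<le> 1 * layer e (norm (y $ j)) (Suc l)"
      using e by (intro mult_right_mono layer_nonneg) (auto simp: norm_sgn)
    also have "\<dots> \<le> (if j \<in> S l then e * 2 ^ l else 0)"
      using layer_Suc_le[of e "norm (y $ j)" l] e by (auto simp: S_def)
    finally show "norm (g l j * (sgn (y $ j) * of_real (layer e (norm (y $ j)) (Suc l))))
      \<le> norm (g l j) * (if j \<in> S l then e * 2 ^ l else 0)"
      using e layer_nonneg[of e "norm (y $ j)" "Suc l"] by (simp add: norm_mult mult_left_mono)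
  qed
  also have "\<dots> = (\<Sum>l<L. e * 2 ^ l * (\<Sum>j\<in>S l. norm (g l j)))"
    by (simp add: sum_distrib_left if_distrib sum.If_cases mult.commute cong: if_cong)
  also have "\<dots> \<le> (\<Sum>l<L. e * 2 ^ l * (2 * sqrt 2 * D * norm (X l) * sqrt (card (S l))))"
    unfolding g_def using e by (intro sum_mono mult_left_mono sum_norm_columns_le) auto
  also have "\<dots> = 2 * sqrt 2 * D * (\<Sum>l<L. \<bar>norm (X l)\<bar> * \<bar>e * 2 ^ l * sqrt (card (S l))\<bar>)"
    unfolding sum_distrib_left using e by (intro sum.cong) (auto simp: abs_mult)
  also have "\<dots> \<le> 2 * sqrt 2 * D * (L2_set (\<lambda>l. norm (X l)) {..<L} * L2_set (\<lambda>l. e * 2 ^ l * sqrt (card (S l))) {..<L})"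
    using discrete_bound_nonneg by (intro mult_left_mono L2_set_mult_ineq) auto
  also have "\<dots> \<le> 2 * sqrt 2 * D * (sqrt K * sqrt (4 / 3))"
  proof (intro mult_left_mono mult_mono)
    \<comment> \<open>Double counting: each nonzero entry of \<open>x\<close> survives in at most
      \<open>K\<close> of the vectors \<open>X l\<close>.\<close>
    have "(\<Sum>l<L. (norm (X l))\<^sup>2) = (\<Sum>i\<in>UNIV. \<Sum>l<L. if W i l then (norm (x $ i))\<^sup>2 else 0)"
      unfolding norm_vec_power2 by (subst sum.swap) (auto simp: X_def intro!: sum.cong)
    also have "\<dots> = (\<Sum>i\<in>UNIV. card {l. l < L \<and> W i l} * (norm (x $ i))\<^sup>2)"
      by (intro sum.cong refl) (simp add: sum.If_cases Int_def)
    also have "\<dots> \<le> (\<Sum>i\<in>UNIV. K * (norm (x $ i))\<^sup>2)"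
    proof (intro sum_mono)
      fix i show "card {l. l < L \<and> W i l} * (norm (x $ i))\<^sup>2 \<le> K * (norm (x $ i))\<^sup>2"
        using W[of i] by (cases "x $ i = 0") (auto intro: mult_right_mono)
    qed
    also have "\<dots> = K" using norm_vec_power2[of x] nx by (simp flip: sum_distrib_left)
    finally show "L2_set (\<lambda>l. norm (X l)) {..<L} \<le> sqrt K" by (simp add: L2_set_def)
    \<comment> \<open>Counting by columns instead of by layers leaves one geometric sum for each
      entry of \<open>y\<close>.\<close>
    have "(\<Sum>l<L. (e * 2 ^ l * sqrt (card (S l)))\<^sup>2) = (\<Sum>l<L. \<Sum>j\<in>UNIV. if e * 2 ^ l < norm (y $ j) then (e * 2 ^ l)\<^sup>2 else 0)"
      by (intro sum.cong refl) (simp add: sum.If_cases S_def power_mult_distrib)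
    also have "\<dots> = (\<Sum>j\<in>UNIV. \<Sum>l<L. if e * 2 ^ l < norm (y $ j) then (e * 2 ^ l)\<^sup>2 else 0)"
      by (rule sum.swap)
    also have "\<dots> \<le> (\<Sum>j\<in>UNIV. 4 / 3 * (norm (y $ j))\<^sup>2)"
      using e by (intro sum_mono sum_dyadic_squares_le) auto
    also have "\<dots> = 4 / 3" using norm_vec_power2[of y] ny unfolding sum_distrib_left[symmetric] by simp
    finally show "L2_set (\<lambda>l. e * 2 ^ l * sqrt (card (S l))) {..<L} \<le> sqrt (4 / 3)"
      by (simp add: L2_set_def)
  qed (use discrete_bound_nonneg in \<open>auto simp: L2_set_nonneg\<close>)
  finally show ?thesis by (simp only: g real_sqrt_mult mult_ac)
qed

text \<open>The scalar off-window estimate in every entry supplies the weights \<open>1 / b\<close>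
  and \<open>2 * a\<close> for \<open>weighted_entry_sum_le\<close>.\<close>

lemma off_window_norm_le:
  fixes x :: "complex ^ 'm" and y :: "complex ^ 'n"
  assumes e: "0 < e" "\<And>i. x $ i \<noteq> 0 \<Longrightarrow> b * e < norm (x $ i)" and b: "0 < b" "0 \<le> a"
    and col: "\<And>j. (\<Sum>i\<in>UNIV. norm (A $ i $ j)) \<le> P" and row: "\<And>i. (\<Sum>j\<in>UNIV. norm (A $ i $ j)) \<le> Q"
    and nx: "norm x = 1" and ny: "norm y = 1"
  shows "norm (\<Sum>i\<in>UNIV. \<Sum>j\<in>UNIV. \<Sum>l\<le>L.
      if a * (e * 2 ^ l) < norm (x $ i) \<and> norm (x $ i) \<le> b * (e * 2 ^ l) then 0
      else cnj (x $ i) * A $ i $ j * (sgn (y $ j) * of_real (layer e (norm (y $ j)) l)))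
    \<le> Q / b + 2 * a * P"
proof -
  define V where "V i l \<longleftrightarrow> a * (e * 2 ^ l) < norm (x $ i) \<and> norm (x $ i) \<le> b * (e * 2 ^ l)" for i l
  have entry: "norm (\<Sum>l\<le>L. if V i l then 0 else cnj (x $ i) * A $ i $ j * (sgn (y $ j) * of_real (layer e (norm (y $ j)) l)))
     \<le> norm (A $ i $ j) * ((norm (x $ i))\<^sup>2 / b + 2 * a * (norm (y $ j))\<^sup>2)" for i j
  proof (cases "x $ i = 0")
    case False
    have "norm (\<Sum>l\<le>L. if V i l then 0 else cnj (x $ i) * A $ i $ j * (sgn (y $ j) * of_real (layer e (norm (y $ j)) l)))
       \<le> (\<Sum>l\<le>L. norm (A $ i $ j) * (norm (x $ i) * (if V i l then 0 else layer e (norm (y $ j)) l)))"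
    proof (intro sum_norm_le)
      fix l
      show "norm (if V i l then 0 else cnj (x $ i) * A $ i $ j * (sgn (y $ j) * of_real (layer e (norm (y $ j)) l)))
        \<le> norm (A $ i $ j) * (norm (x $ i) * (if V i l then 0 else layer e (norm (y $ j)) l))"
        using e layer_nonneg[of e "norm (y $ j)" l]
        by (cases "y $ j = 0") (auto simp: norm_mult norm_sgn)
    qed
    also have "\<dots> = norm (A $ i $ j) * (norm (x $ i) * (\<Sum>l\<le>L. if V i l then 0 else layer e (norm (y $ j)) l))"
      by (simp only: sum_distrib_left)
    also have "\<dots> \<le> norm (A $ i $ j) * ((norm (x $ i))\<^sup>2 / b + 2 * a * (norm (y $ j))\<^sup>2)"
      unfolding V_def using e False b by (intro mult_left_mono off_window_sum_le) auto
    finally show ?thesis .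
  qed (use b in \<open>simp cong: if_cong\<close>)
  have "norm (\<Sum>i\<in>UNIV. \<Sum>j\<in>UNIV. \<Sum>l\<le>L. if V i l then 0
        else cnj (x $ i) * A $ i $ j * (sgn (y $ j) * of_real (layer e (norm (y $ j)) l)))
    \<le> (\<Sum>i\<in>UNIV. \<Sum>j\<in>UNIV. norm (A $ i $ j) * ((norm (x $ i))\<^sup>2 * (1 / b) + 2 * a * (norm (y $ j))\<^sup>2))"
    using entry by (intro sum_norm_le) simp
  also have "\<dots> \<le> Q * (1 / b) + P * (2 * a)"
    using weighted_entry_sum_le[OF col row _ _ nx ny, of "1 / b" "2 * a"] b by (simp add: mult.commute)
  finally show ?thesis by (simp add: V_def mult.commute)
qed

lemma bilinear_form_le:
  fixes x :: "complex ^ 'm" and y :: "complex ^ 'n"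
  assumes b: "0 < b"
    and col: "\<And>j. (\<Sum>i\<in>UNIV. norm (A $ i $ j)) \<le> P" and row: "\<And>i. (\<Sum>j\<in>UNIV. norm (A $ i $ j)) \<le> Q"
    and nx: "norm x = 1" and ny: "norm y = 1"
  shows "norm (\<Sum>i\<in>UNIV. cnj (x $ i) * (A *v y) $ i)
    \<le> 2 * sqrt 2 * D * sqrt (4 / 3 * real K) + (Q / b + 2 * (b / 2 ^ K) * P)"
proof -
  \<comment> \<open>The extra element 1 makes \<open>F\<close> visibly nonempty. With
    \<open>e\<close> as below, \<open>b * e\<close> is half the minimum of \<open>F\<close>, hence
    below every nonzero modulus of \<open>x\<close>.\<close>
  define F where "F = insert 1 (norm ` {x $ i |i. x $ i \<noteq> 0})"
  have F: "finite F" "F \<noteq> {}" unfolding F_def by auto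
  then have "Min F \<in> F" by (rule Min_in)
  then have F0: "0 < Min F" by (auto simp: F_def)
  define e where "e = Min F / (2 * b)"
  have e: "0 < e" using F0 b by (simp add: e_def)
  have ex: "b * e < norm (x $ i)" if "x $ i \<noteq> 0" for i
  proof -
    have "Min F \<le> norm (x $ i)" using that F by (intro Min_le) (auto simp: F_def)
    moreover have "b * e = Min F / 2" using b by (simp add: e_def)
    ultimately show ?thesis using F0 by linarith
  qed
  \<comment> \<open>The top height \<open>e * 2 ^ L\<close> exceeds 1, hence every modulus of the
    unit vector \<open>y\<close>, so the layers up to \<open>L\<close> recover each entry in
    full.\<close>
  obtain L where L: "1 / e < 2 ^ L"
    using real_arch_pow[of 2 "1 / e"] by auto
  have lay: "(\<Sum>l\<le>L. layer e (norm (y $ j)) l) = norm (y $ j)" for j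
  proof -
    have "norm (y $ j) \<le> 1" using Finite_Cartesian_Product.norm_nth_le[of y j] ny by simp
    also have "1 \<le> e * 2 ^ L" using L e by (simp add: field_simps)
    finally show ?thesis by (simp add: sum_layer)
  qed
  define a where "a = b / 2 ^ K"
  have a: "0 \<le> a" using b by (simp add: a_def)
  define V where "V i l \<longleftrightarrow> a * (e * 2 ^ l) < norm (x $ i) \<and> norm (x $ i) \<le> b * (e * 2 ^ l)" for i l
  define t where "t i j l = cnj (x $ i) * A $ i $ j * (sgn (y $ j) * of_real (layer e (norm (y $ j)) l))" for i j l
  \<comment> \<open>\<open>e\<close> is so small that layer 0, the only one not contained in a dyadic interval, lies below every window.\<close>
  have V0: "(if V i 0 then t i j 0 else 0) = 0" for i j
    using ex[of i] by (auto simp: V_def t_def)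
  have "(\<Sum>i\<in>UNIV. cnj (x $ i) * (A *v y) $ i) = (\<Sum>i\<in>UNIV. \<Sum>j\<in>UNIV. cnj (x $ i) * A $ i $ j * y $ j)"
    by (simp add: matrix_vector_mult_def sum_distrib_left mult.assoc)
  also have "\<dots> = (\<Sum>i\<in>UNIV. \<Sum>j\<in>UNIV. \<Sum>l\<le>L. t i j l)"
  proof (intro sum.cong refl)
    fix i j
    have "y $ j = sgn (y $ j) * of_real (\<Sum>l\<le>L. layer e (norm (y $ j)) l)"
      unfolding lay by (simp add: sgn_eq)
    then show "cnj (x $ i) * A $ i $ j * y $ j = (\<Sum>l\<le>L. t i j l)"
      unfolding t_def sum_distrib_left[symmetric] of_real_sum[symmetric] by simp
  qed
  also have "\<dots> = (\<Sum>i\<in>UNIV. \<Sum>j\<in>UNIV. \<Sum>l\<le>L. (if V i l then t i j l else 0) + (if V i l then 0 else t i j l))"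
    by (intro sum.cong) auto
  also have "\<dots> = (\<Sum>i\<in>UNIV. \<Sum>j\<in>UNIV. \<Sum>l\<le>L. if V i l then t i j l else 0)
      + (\<Sum>i\<in>UNIV. \<Sum>j\<in>UNIV. \<Sum>l\<le>L. if V i l then 0 else t i j l)"
    by (simp only: sum.distrib)
  also have "(\<Sum>i\<in>UNIV. \<Sum>j\<in>UNIV. \<Sum>l\<le>L. if V i l then t i j l else 0)
      = (\<Sum>i\<in>UNIV. \<Sum>j\<in>UNIV. \<Sum>l<L. if V i (Suc l) then t i j (Suc l) else 0)"
    by (simp only: sum.atMost_shift V0 add_0_left)
  also have "\<dots> = (\<Sum>i\<in>UNIV. \<Sum>l<L. \<Sum>j\<in>UNIV. if V i (Suc l) then t i j (Suc l) else 0)"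
    by (intro sum.cong refl sum.swap)
  also have "\<dots> = (\<Sum>l<L. \<Sum>i\<in>UNIV. \<Sum>j\<in>UNIV. if V i (Suc l) then t i j (Suc l) else 0)"
    by (rule sum.swap)
  also have "\<dots> = (\<Sum>l<L. \<Sum>j\<in>UNIV. \<Sum>i\<in>UNIV. if V i (Suc l) then t i j (Suc l) else 0)"
    by (intro sum.cong refl sum.swap)
  also have "\<dots> = (\<Sum>l<L. \<Sum>j\<in>UNIV. (\<Sum>i\<in>UNIV. if V i (Suc l) then cnj (x $ i) * A $ i $ j else 0)
             * (sgn (y $ j) * of_real (layer e (norm (y $ j)) (Suc l))))"
    unfolding sum_distrib_right by (intro sum.cong) (auto simp: t_def)
  finally have split: "(\<Sum>i\<in>UNIV. cnj (x $ i) * (A *v y) $ i) = \<dots> + (\<Sum>i\<in>UNIV. \<Sum>j\<in>UNIV. \<Sum>l\<le>L. if V i l then 0 else t i j l)" .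
  have card: "card {l. l < L \<and> V i (Suc l)} \<le> K" if "x $ i \<noteq> 0" for i
  proof -
    \<comment> \<open>The 2 in the denominator comes from the shift: the window is tested at height
      \<open>e * 2 ^ Suc l\<close>.\<close>
    define u where "u = norm (x $ i) / (2 * b * e)"
    have "V i (Suc l) \<longleftrightarrow> u \<le> 2 ^ l \<and> 2 ^ l < u * 2 ^ K" for l
      using b e by (auto simp: V_def u_def a_def field_simps)
    moreover have "0 < u" using that b e by (simp add: u_def)
    ultimately show ?thesis using card_dyadic_window_le[of u "{..<L}" K] by simp
  qed
  show ?thesis unfolding split
    using on_window_sum_le[OF e card nx ny] off_window_norm_le[OF e ex b a col row nx ny, where L = L]
    unfolding V_def[symmetric] t_def[symmetric] a_def[symmetric]
    by (intro norm_triangle_le add_mono) auto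
qed

end

section \<open>Choice of parameters and conclusion\<close>

theorem theorem1:
  fixes A :: "complex ^ 'n ^ 'm"
  assumes "A \<noteq> 0"
  shows "mat_norm A / (8 * sqrt 2 * sqrt (ln (height A) + 2)) \<le> discrete_norm A
       \<and> discrete_norm A \<le> mat_norm A"
proof
  define N D P Q h where "N = mat_norm A" and "D = discrete_norm A" and "P = mat_norm_1 A"
    and "Q = mat_norm_inf A" and "h = height A"
  have le_N: "norm (A *v v) \<le> N * norm v" for v
    unfolding N_def mat_norm_def by (rule onorm) simp
  show "discrete_norm A \<le> mat_norm A"
    unfolding discrete_norm_def
  proof (rule Max.boundedI)
    fix r assume "r \<in> (\<lambda>\<xi>. norm (A *v \<xi>) / norm \<xi>) ` (binary_vectors - {0})"
    then obtain \<xi> where "r = norm (A *v \<xi>) / norm \<xi>" "\<xi> \<noteq> 0" by blast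
    then show "r \<le> mat_norm A" using le_N[of \<xi>] by (simp add: N_def pos_divide_le_eq)
  qed (use finite_binary_vectors binary_vectors_nonzero in auto)
  have D: "norm (A *v \<xi>) \<le> D * norm \<xi>" if "\<xi> \<in> binary_vectors" for \<xi>
  proof (cases "\<xi> = 0")
    case False
    then have "norm (A *v \<xi>) / norm \<xi> \<le> D"
      unfolding D_def discrete_norm_def using that finite_binary_vectors by (intro Max_ge) auto
    then show ?thesis using False by (simp add: divide_le_eq)
  qed simp
  have D0: "0 \<le> D" using discrete_bound_nonneg[of A D] D by blast
  have col: "(\<Sum>i\<in>UNIV. norm (A $ i $ j)) \<le> P" for j
    unfolding P_def mat_norm_1_eq_max_column_sum by (intro Max_ge) auto
  have row: "(\<Sum>j\<in>UNIV. norm (A $ i $ j)) \<le> Q" for i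
    unfolding Q_def mat_norm_inf_eq_max_row_sum by (intro Max_ge) auto
  obtain i j where "A $ i $ j \<noteq> 0" using assms by (auto simp: vec_eq_iff)
  then have Aij: "0 < norm (A $ i $ j)" by simp
  have P: "0 < P"
    using Aij col[of j] member_le_sum[of i UNIV "\<lambda>i. norm (A $ i $ j)"] by (simp del: zero_less_norm_iff)
  have Q: "0 < Q"
    using Aij row[of i] member_le_sum[of j UNIV "\<lambda>j. norm (A $ i $ j)"] by (simp del: zero_less_norm_iff)
  obtain v where "A *v v \<noteq> 0" using assms by (metis matrix_eq matrix_vector_mult_0)
  then have "0 < N * norm v" using le_N[of v] by (meson less_le_trans zero_less_norm_iff)
  then have N: "0 < N" by (simp add: zero_less_mult_iff)
  have h: "h = sqrt (P * Q) / N" by (simp add: h_def height_def P_def Q_def N_def)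
  have h1: "1 \<le> h" using Schur_test[OF P Q col row] N by (simp add: h N_def)
  \<comment> \<open>The least \<open>K\<close> with \<open>2 ^ K\<close> at least
    \<open>32 * h\<^sup>2\<close>, the size that makes the discarded part at most
    \<open>N / 2\<close>.\<close>
  define K where "K = nat \<lceil>log 2 (32 * h\<^sup>2)\<rceil>"
  have "32 * h\<^sup>2 = 2 powr log 2 (32 * h\<^sup>2)"
    using h1 by (intro powr_log_cancel[symmetric]) auto
  also have "\<dots> \<le> 2 powr K"
    by (intro powr_mono) (simp_all add: K_def real_nat_ceiling_ge)
  also have "\<dots> = 2 ^ K" by (simp only: powr_realpow zero_less_numeral)
  finally have hK: "32 * h\<^sup>2 \<le> 2 ^ K" .
  have log32: "log 2 (32 * h\<^sup>2) = 5 + 2 * log 2 h"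
  proof -
    have "log 2 (32 * h\<^sup>2) = log 2 (2 ^ 5) + log 2 (h\<^sup>2)"
      using h1 by (subst log_mult_pos[symmetric]) auto
    also have "\<dots> = 5 + 2 * log 2 h"
      using h1 by (subst (1 2) log_nat_power) auto
    finally show ?thesis .
  qed
  have lnh: "0 \<le> ln h" using h1 by simp
  \<comment> \<open>Passing to the natural logarithm uses that \<open>ln 2\<close> is at least
    2/3.\<close>
  have "ln h * 2 \<le> ln h * (3 * ln 2)"
    using mult_left_mono[OF ln2_ge_two_thirds lnh] by simp
  then have "ln h * 2 / ln 2 \<le> ln h * 3"
    by (subst pos_divide_le_eq) (simp_all add: mult.assoc)
  then have log_h: "2 * log 2 h \<le> 3 * ln h" by (simp add: log_def mult.commute)
  have "0 \<le> log 2 h" using h1 by (simp only: zero_le_log_cancel_iff)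
  then have "0 \<le> log 2 (32 * h\<^sup>2)" unfolding log32 by linarith
  \<comment> \<open>The 5 from \<open>log 2 32\<close> and the 1 from rounding up give 6, which
    becomes the \<open>+ 2\<close> of the theorem once 3 is factored out.\<close>
  then have "K \<le> log 2 (32 * h\<^sup>2) + 1"
    unfolding K_def by linarith
  also have "\<dots> = 6 + 2 * log 2 h" unfolding log32 by simp
  also have "\<dots> \<le> 3 * (ln h + 2)" using log_h by simp
  finally have K: "K \<le> 3 * (ln h + 2)" .
  define c :: real where "c = 2 ^ K"
  have c: "0 < c" by (simp add: c_def)
  \<comment> \<open>This \<open>b\<close> makes \<open>Q / b\<close> equal to
    \<open>2 * (b / c) * P\<close>, which minimizes their sum.\<close>
  define b where "b = sqrt (Q * c / (2 * P))"
  have b: "0 < b" and b2: "b\<^sup>2 = Q * c / (2 * P)" using P Q c by (auto simp: b_def)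
  have Q_eq: "Q = 2 * P * b\<^sup>2 / c"
    unfolding b2 using P c by simp
  have "Q / b = (2 * P * b\<^sup>2 / c) / b" by (subst Q_eq) (rule refl)
  also have "\<dots> = 2 * (b / c) * P" using b by (simp add: power2_eq_square)
  finally have Qb: "Q / b = 2 * (b / c) * P" .
  have tail: "Q / b + 2 * (b / c) * P \<le> N / 2"
  proof -
    have "h\<^sup>2 = P * Q / N\<^sup>2" unfolding h power_divide using P Q by simp
    then have "32 * (P * Q) = 32 * h\<^sup>2 * N\<^sup>2" using N by simp
    also have "\<dots> \<le> c * N\<^sup>2" using hK unfolding c_def by (rule mult_right_mono) simp
    finally have "32 * (P * Q) / c \<le> N\<^sup>2" using c by (simp add: pos_divide_le_eq mult.commute)
    moreover have "(8 * b * P / c)\<^sup>2 = 32 * (P * (2 * P * b\<^sup>2 / c)) / c"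
      by (simp add: power2_eq_square)
    ultimately have "(8 * b * P / c)\<^sup>2 \<le> N\<^sup>2"
      unfolding Q_eq[symmetric] by simp
    then have "8 * b * P / c \<le> N" by (rule power2_le_imp_le) (use N in simp)
    then show ?thesis unfolding Qb by (simp add: mult_ac)
  qed
  \<comment> \<open>The discarded part is absorbed into the left-hand side, which doubles the
    constant of the kept part.\<close>
  have "N \<le> 2 * sqrt 2 * D * sqrt (4 / 3 * K) + N / 2"
    unfolding N_def
  proof (rule mat_norm_leI)
    fix x :: "complex ^ 'm" and y :: "complex ^ 'n" assume "norm x = 1" "norm y = 1"
    from order_trans[OF bilinear_form_le[OF D b col row this, of K] add_left_mono[OF tail[unfolded c_def]]]
    show "norm (\<Sum>i\<in>UNIV. cnj (x $ i) * (A *v y) $ i) \<le> 2 * sqrt 2 * D * sqrt (4 / 3 * K) + mat_norm A / 2"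
      unfolding N_def .
  qed (use D0 N in \<open>simp add: N_def\<close>)
  then have "N \<le> 4 * sqrt 2 * D * sqrt (4 / 3 * K)" by linarith
  \<comment> \<open>The 3 in the bound for \<open>K\<close> cancels the denominator of 4/3; the
    remaining \<open>sqrt 4\<close> turns \<open>4 * sqrt 2\<close> into
    \<open>8 * sqrt 2\<close>.\<close>
  also have "\<dots> \<le> 4 * sqrt 2 * D * sqrt (4 * (ln h + 2))"
    using K D0 by (intro mult_left_mono real_sqrt_le_mono) auto
  also have "\<dots> = D * (8 * sqrt 2 * sqrt (ln h + 2))"
    unfolding real_sqrt_mult[of 4] by simp
  finally show "mat_norm A / (8 * sqrt 2 * sqrt (ln (height A) + 2)) \<le> discrete_norm A"
    using lnh unfolding N_def D_def h_def by (subst pos_divide_le_eq) auto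
qed

end
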